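(* Let $m,n,t>0$ be integers with $t\le n$, and let $a,b\ge 0$ be integers with $a+b\le n-t$. (i) The number of small $(m,t)$-Schröder paths of height $n$ with exactly $b$ returns and exactly $n-t-a-b$ diagonal steps is $$\frac{t+b}{n}\binom{mn+a-1}{a}\binom{mn}{n-t-a-b}.$$ (ii) The number of $m$-divisible small $(m,t)$-Schröder paths of height $n$ with exactly $b$ returns and exactly $n-t-a-b$ diagonal steps is $$\frac{t+b}{n}\binom{mn+a-1}{a}\binom{n}{n-t-a-b}.$$
   Context: A small $(m,t)$-Schröder path of height $n$ is a lattice path from $(0,0)$ to $(mn,n)$ such that: it uses only steps $N=(0,1)$ (north), $E=(1,0)$ (east) or $D=(1,1)$ (diagonal); it stays weakly above the line $x=my$ (every lattice point $(p,q)$ visited satisfies $p\le mq$); it starts with at least $t$ north steps; and it has no diagonal step starting on the line $x=my$. It is $m$-divisible if every diagonal step ends at a point whose $x$-coordinate is divisible by $m$. A valley is a lattice point on the path preceded by an east step and followed by a north step; a return is a valley of the form $(mi,i)$ for some $i\in\{1,\ldots,n-1\}$. *)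

theory Defs
  imports Complex_Main
begin

text \<open>A lattice path from the origin is encoded as the list of its steps.\<close>

datatype step = North | East | Diag

fun step_vec :: "step \<Rightarrow> nat \<times> nat" where
  "step_vec North = (0, 1)"
| "step_vec East = (1, 0)"
| "step_vec Diag = (1, 1)"

text \<open>The lattice point at which the path stands after its first \<open>k\<close> steps.\<close>

definition point :: "step list \<Rightarrow> nat \<Rightarrow> nat \<times> nat" where
  "point w k = (\<Sum>s\<leftarrow>take k w. fst (step_vec s), \<Sum>s\<leftarrow>take k w. snd (step_vec s))"

text \<open>In \<open>small_schroeder m t n w\<close>, step \<open>i\<close> leads from \<open>point w i\<close> to \<open>point w (Suc i)\<close>.\<close>

definition small_schroeder :: "nat \<Rightarrow> nat \<Rightarrow> nat \<Rightarrow> step list \<Rightarrow> bool" where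
  "small_schroeder m t n w \<longleftrightarrow>
     point w (length w) = (m * n, n) \<and>
     (\<forall>k\<le>length w. fst (point w k) \<le> m * snd (point w k)) \<and>
     t \<le> length w \<and> (\<forall>i<t. w ! i = North) \<and>
     (\<forall>i<length w. w ! i = Diag \<longrightarrow> fst (point w i) \<noteq> m * snd (point w i))"

definition m_divisible :: "nat \<Rightarrow> step list \<Rightarrow> bool" where
  "m_divisible m w \<longleftrightarrow> (\<forall>i<length w. w ! i = Diag \<longrightarrow> m dvd fst (point w (Suc i)))"

definition valleys :: "step list \<Rightarrow> (nat \<times> nat) set" where
  "valleys w = {point w (Suc i) | i. Suc i < length w \<and> w ! i = East \<and> w ! Suc i = North}"

definition returns :: "nat \<Rightarrow> nat \<Rightarrow> step list \<Rightarrow> (nat \<times> nat) set" where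
  "returns m n w = {v \<in> valleys w. \<exists>i\<in>{1..n-1}. v = (m * i, i)}"

definition num_diag :: "step list \<Rightarrow> nat" where
  "num_diag w = count_list w Diag"

end

theory Submission
  imports Defs
begin

text \<open>
  A small Schroeder path must leave every return by a north step. Deleting the first \<open>t\<close> north
  steps and the north step after each of the \<open>b\<close> returns leaves \<open>a\<close> north steps and \<open>d = n - t - a - b\<close>
  diagonal steps, freely distributed over \<open>m * n\<close> columns (over the columns ending at a multiple
  of \<open>m\<close>, for the diagonal steps of an \<open>m\<close>-divisible path), subject only to the condition that
  the level, started at \<open>m * (t + b)\<close>, reaches \<open>0\<close> for the first time at the end. This condition need only be
  tested at multiples of \<open>m\<close>, so by the cycle lemma exactly \<open>t + b\<close> of the \<open>n\<close> rotations by
  multiples of \<open>m\<close> satisfy it. Both counts are instances, \<open>e = 1\<close> and \<open>e = m\<close>, of the one for a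
  divisor \<open>e\<close> of \<open>m\<close>.
\<close>

section \<open>The cycle lemma\<close>

text \<open>The cycle lemma for a sequence that climbs by at most 1 but may drop by any amount, as a
  block of columns may contain any number of north steps. It counts the starts \<open>r\<close> from
  which the gain first reaches \<open>c\<close> at time \<open>n\<close>.\<close>

lemma records_per_period:
  fixes S :: "nat \<Rightarrow> int"
  assumes period: "\<And>i. S (i + n) = S i + int c"
    and step: "\<And>i. S (Suc i) \<le> S i + 1"
    and "n > 0"
  shows "card {r. r < n \<and> (\<forall>i<n. S (r + i) < S r + int c)} = c"
proof -
  define R where "R p = Max (S ` {..p})" for p
  have R_ge: "S i \<le> R p" if "i \<le> p" for i p
    unfolding R_def using that by (intro Max_ge) auto
  have R_attained: "\<exists>i\<le>p. R p = S i" for p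
  proof -
    have "R p \<in> S ` {..p}"
      unfolding R_def by (rule Max_in) auto
    then show ?thesis by auto
  qed
  have R_Suc: "R (Suc p) = max (S (Suc p)) (R p)" for p
    unfolding R_def atMost_Suc by (simp add: Max_insert)
  \<comment> \<open>The good \<open>r\<close> are those for which \<open>r + n\<close> is a strict record of \<open>S\<close>; records raise the
    running maximum \<open>R\<close> by exactly \<open>1\<close>, so their number in a period is the growth of \<open>R\<close>.\<close>
  have R_step: "R (Suc p) - R p = of_bool (\<forall>j\<le>p. S j < S (Suc p))" for p
  proof (cases "\<forall>j\<le>p. S j < S (Suc p)")
    case True
    obtain i where "i \<le> p" "R p = S i"
      using R_attained by blast
    then have "R p < S (Suc p)"
      using True by auto
    moreover have "S (Suc p) \<le> R p + 1"
      using step[of p] R_ge[of p p] by linarith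
    ultimately show ?thesis
      using True R_Suc[of p] by auto
  next
    case False
    then obtain j where "j \<le> p" "S (Suc p) \<le> S j"
      by (meson not_less)
    then have "S (Suc p) \<le> R p"
      using R_ge[of j p] by linarith
    then show ?thesis
      using False R_Suc[of p] by auto
  qed
  \<comment> \<open>From \<open>p = n - 1\<close> on, every index below \<open>n\<close> already
    lies in \<open>{..p}\<close>, so only indices from \<open>n\<close> on have to be shifted back
    by a period.\<close>
  have R_period: "R (p + n) = R p + int c" if "n \<le> Suc p" for p
  proof (rule antisym)
    obtain i where i: "i \<le> p + n" "R (p + n) = S i"
      using R_attained by blast
    show "R (p + n) \<le> R p + int c"
    proof (cases "i < n")
      case True
      then show ?thesis
        using i that R_ge[of i p] by simp
    next
      case False
      then show ?thesis
        using i period[of "i - n"] R_ge[of "i - n" p] by simp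
    qed
    obtain i where "i \<le> p" "R p = S i"
      using R_attained by blast
    then show "R p + int c \<le> R (p + n)"
      using period[of i] R_ge[of "i + n" "p + n"] by simp
  qed
  have multiple_periods: "S (i + k * n) = S i + int k * int c" for i k
  proof (induction k)
    case (Suc k)
    have "S (i + Suc k * n) = S ((i + k * n) + n)"
      by (simp add: algebra_simps)
    then show ?case
      using Suc period[of "i + k * n"] by (simp add: algebra_simps)
  qed simp
  have good_iff: "(\<forall>i<n. S (r + i) < S r + int c) \<longleftrightarrow> (\<forall>j<r + n. S j < S (r + n))" for r
  proof
    assume good: "\<forall>i<n. S (r + i) < S r + int c"
    show "\<forall>j<r + n. S j < S (r + n)"
    proof (intro allI impI)
      fix j assume j: "j < r + n"
      show "S j < S (r + n)"
      proof (cases "r \<le> j")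
        case True
        then show ?thesis
          using good[rule_format, of "j - r"] j period[of r] by simp
      next
        case False
        \<comment> \<open>\<open>q\<close> is the least number of periods that carries
          \<open>j\<close> to \<open>r\<close> or beyond; it lands at
          \<open>r + (n - 1 - i)\<close>, inside the window starting at \<open>r\<close>.\<close>
        define q where "q = (r - j + n - 1) div n"
        define i where "i = (r - j + n - 1) mod n"
        have q: "r - j + n - 1 = q * n + i"
          unfolding q_def i_def by simp
        have "i < n"
          unfolding i_def using \<open>n > 0\<close> by simp
        then have "j + q * n = r + (n - 1 - i)"
          using q False by linarith
        moreover have "S (r + (n - 1 - i)) < S r + int c"
          using good \<open>n > 0\<close> by simp
        ultimately have "S j + int q * int c < S r + int c"
          using multiple_periods[of j q] by simp
        moreover have "0 \<le> int q * int c"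
          by simp
        ultimately show ?thesis
          using period[of r] by linarith
      qed
    qed
  next
    assume "\<forall>j<r + n. S j < S (r + n)"
    then show "\<forall>i<n. S (r + i) < S r + int c"
      using period[of r] by simp
  qed
  have "int (card {r. r < n \<and> (\<forall>i<n. S (r + i) < S r + int c)})
      = (\<Sum>r<n. of_bool (\<forall>j<r + n. S j < S (r + n)))"
    by (simp add: good_iff lessThan_def Int_def flip: Collect_conj_eq)
  also have "\<dots> = (\<Sum>r<n. R (Suc r + n - 1) - R (r + n - 1))"
  proof (rule sum.cong[OF refl])
    fix r
    obtain p where p: "r + n = Suc p"
      using \<open>n > 0\<close> by (cases "r + n") auto
    show "of_bool (\<forall>j<r + n. S j < S (r + n)) = R (Suc r + n - 1) - R (r + n - 1)"
      using R_step[of p] p by (simp add: less_Suc_eq_le)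
  qed
  \<comment> \<open>Telescoping runs over exactly one period, starting at \<open>n - 1\<close>, the
    first index where \<open>R_period\<close> applies.\<close>
  also have "\<dots> = R (n + n - 1) - R (n - 1)"
    by (subst sum_lessThan_telescope) simp
  also have "\<dots> = int c"
    using R_period[of "n - 1"] \<open>n > 0\<close> by simp
  finally show ?thesis
    by simp
qed

section \<open>Columns\<close>

type_synonym column = "nat \<times> bool"

text \<open>The column \<open>(k, s)\<close> stands for \<open>k\<close> north steps followed by a step to the right, which is
  diagonal iff \<open>s\<close>.\<close>

definition rise :: "column \<Rightarrow> nat" where
  "rise c = fst c + of_bool (snd c)"

abbreviation height :: "column list \<Rightarrow> nat" where
  "height cs \<equiv> sum_list (map rise cs)"

fun col_word :: "column \<Rightarrow> step list" where
  "col_word (k, s) = replicate k North @ [if s then Diag else East]"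

abbreviation word :: "column list \<Rightarrow> step list" where
  "word cs \<equiv> concat (map col_word cs)"

text \<open>Columns of a path that starts at level \<open>z = m * y - x\<close>, ends on the line and meets it at
  exactly \<open>b\<close> earlier points.\<close>

fun path_cols :: "nat \<Rightarrow> nat \<Rightarrow> nat \<Rightarrow> column list \<Rightarrow> bool" where
  "path_cols m z b [] \<longleftrightarrow> z = 0 \<and> b = 0"
| "path_cols m z b (c # cs) \<longleftrightarrow>
     (if z = 0 then b > 0 \<and> fst c > 0 \<and> path_cols m (m * rise c - 1) (b - 1) cs
      else path_cols m (z + m * rise c - 1) b cs)"

text \<open>The guard \<open>z > 0\<close> keeps the subtraction exact. Testing only between columns
  suffices because north steps never lower the level.\<close>

fun first_hit :: "nat \<Rightarrow> nat \<Rightarrow> column list \<Rightarrow> bool" where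
  "first_hit m z [] \<longleftrightarrow> z = 0"
| "first_hit m z (c # cs) \<longleftrightarrow> z > 0 \<and> first_hit m (z + m * rise c - 1) cs"

text \<open>Removes the north step that leaves each point on the line. The tracked \<open>z\<close>
  is the level of the original path, so a deletion does not affect where later ones occur.\<close>

fun lower :: "nat \<Rightarrow> nat \<Rightarrow> column list \<Rightarrow> column list" where
  "lower m z [] = []"
| "lower m z (c # cs) =
     (if z = 0 then (fst c - 1, snd c) # lower m (m * rise c - 1) cs
      else c # lower m (z + m * rise c - 1) cs)"

text \<open>Undoes \<open>lower\<close>: here \<open>z\<close> is the level of the path being
  rebuilt, hence \<open>Suc (rise c)\<close> after an insertion.\<close>

fun lift :: "nat \<Rightarrow> nat \<Rightarrow> column list \<Rightarrow> column list" where
  "lift m z [] = []"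
| "lift m z (c # cs) =
     (if z = 0 then (Suc (fst c), snd c) # lift m (m * Suc (rise c) - 1) cs
      else c # lift m (z + m * rise c - 1) cs)"

lemma map_snd_lower: "map snd (lower m z cs) = map snd cs"
  by (induction cs arbitrary: z) auto

lemma map_snd_lift: "map snd (lift m z cs) = map snd cs"
  by (induction cs arbitrary: z) auto

text \<open>The level of the shortened path exceeds that of the original by \<open>m\<close> times
  the number of visits to the line still to come. Each deletion takes one \<open>m\<close> from this
  surplus, so the shortened path reaches level 0 only when the original does with no visits
  left.\<close>

lemma lower_path_cols:
  assumes "m > 0" "path_cols m z b cs"
  shows "first_hit m (z + m * b) (lower m z cs) \<and> lift m z (lower m z cs) = cs"
  using assms(2)
proof (induction cs arbitrary: z b)
  case (Cons c cs)
  show ?case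
  proof (cases "z = 0")
    case True
    with Cons.prems obtain b' k where b: "b = Suc b'" and k: "fst c = Suc k"
      and cs: "path_cols m (m * rise c - 1) b' cs"
      by (auto simp: gr0_conv_Suc)
    have rise: "rise c = Suc (rise (k, snd c))"
      using k by (simp add: rise_def)
    show ?thesis
      using Cons.IH[OF cs] True \<open>m > 0\<close>
      by (auto simp: b k rise algebra_simps intro: prod_eqI)
  next
    case False
    then have "path_cols m (z + m * rise c - 1) b cs"
      using Cons.prems by simp
    from Cons.IH[OF this] False show ?thesis
      by (auto simp: algebra_simps)
  qed
qed auto

text \<open>The same surplus read backwards: while a column remains, \<open>z + m * b\<close> is
  positive, so whenever the rebuilt path is at level 0 a further visit is available.\<close>

lemma lift_first_hit:
  assumes "m > 0" "first_hit m (z + m * b) cs"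
  shows "path_cols m z b (lift m z cs) \<and> lower m z (lift m z cs) = cs"
  using assms(2)
proof (induction cs arbitrary: z b)
  case Nil
  then show ?case using \<open>m > 0\<close> by simp
next
  case (Cons c cs)
  show ?case
  proof (cases "z = 0")
    case True
    with Cons.prems have "b > 0"
      by auto
    then obtain b' where b: "b = Suc b'"
      by (auto simp: gr0_conv_Suc)
    have rise: "rise (Suc (fst c), snd c) = Suc (rise c)"
      by (simp add: rise_def)
    have "first_hit m (m * Suc (rise c) - 1 + m * b') cs"
      using Cons.prems True \<open>m > 0\<close> by (simp add: b algebra_simps)
    from Cons.IH[OF this] True show ?thesis
      by (auto simp: b rise)
  next
    case False
    then have "first_hit m (z + m * rise c - 1 + m * b) cs"
      using Cons.prems by (simp add: algebra_simps)
    from Cons.IH[OF this] False show ?thesis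
      by auto
  qed
qed

text \<open>Unrolls the recursion: after \<open>j\<close> columns the level is
  \<open>z + m * height (take j cs) - j\<close>.\<close>

lemma first_hit_iff:
  "first_hit m z cs \<longleftrightarrow>
     (\<forall>j<length cs. j < z + m * height (take j cs)) \<and> length cs = z + m * height cs"
proof (induction cs arbitrary: z)
  case (Cons c cs)
  have "(\<forall>j<length (c # cs). j < z + m * height (take j (c # cs))) \<longleftrightarrow>
      z > 0 \<and> (\<forall>j<length cs. Suc j < z + m * height (c # take j cs))"
    by (simp add: All_less_Suc2)
  then show ?case
    using Cons[of "z + m * rise c - 1"] by (auto simp: algebra_simps)
qed auto

text \<open>At \<open>j = m * i\<close> a strict inequality between multiples of \<open>m\<close>
  leaves a gap of at least \<open>m\<close>. As heights of prefixes never decrease, this covers all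
  \<open>j\<close> from \<open>m * i\<close> to \<open>m * i + m - 1\<close>.\<close>

lemma first_hit_blocks:
  assumes "m > 0" "length cs = m * n"
  shows "first_hit m (m * c) cs \<longleftrightarrow>
     (\<forall>i<n. i < c + height (take (m * i) cs)) \<and> n = c + height cs"
proof -
  have "(\<forall>j<m * n. j < m * c + m * height (take j cs)) \<longleftrightarrow>
      (\<forall>i<n. i < c + height (take (m * i) cs))" (is "?L \<longleftrightarrow> ?R")
  proof
    assume L: ?L
    show ?R
    proof (intro allI impI)
      fix i assume "i < n"
      then have "m * i < m * n"
        using \<open>m > 0\<close> by simp
      then have "m * i < m * (c + height (take (m * i) cs))"
        using L by (simp add: algebra_simps)
      then show "i < c + height (take (m * i) cs)"
        by simp
    qed
  next
    assume R: ?R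
    show ?L
    proof (intro allI impI)
      fix j assume "j < m * n"
      define i where "i = j div m"
      have j: "j = m * i + j mod m"
        by (simp add: i_def)
      have "i < n"
        using \<open>j < m * n\<close> by (simp add: i_def less_mult_imp_div_less mult.commute)
      then have i: "Suc i \<le> c + height (take (m * i) cs)"
        using R by (simp add: Suc_le_eq)
      have "take j cs = take (m * i) cs @ take (j mod m) (drop (m * i) cs)"
        by (subst j) (rule take_add)
      then have "height (take (m * i) cs) \<le> height (take j cs)"
        by simp
      with i have "m * Suc i \<le> m * (c + height (take j cs))"
        by (intro mult_le_mono) auto
      moreover have "j < m * Suc i"
        using j mod_less_divisor[OF \<open>m > 0\<close>, of j] by simp
      ultimately show "j < m * c + m * height (take j cs)"
        by (simp add: algebra_simps)
    qed
  qed
  moreover have "m * n = m * c + m * height cs \<longleftrightarrow> n = c + height cs"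
    using \<open>m > 0\<close> by (metis add_mult_distrib2 mult_cancel1 not_gr_zero)
  ultimately show ?thesis
    by (simp add: first_hit_iff assms(2))
qed

section \<open>Rotations of column lists\<close>

lemma sum_list_rotate:
  fixes f :: "'a \<Rightarrow> nat"
  shows "sum_list (map f (rotate p xs)) = sum_list (map f xs)"
proof (induction p)
  case (Suc p)
  then show ?case
    by (cases "rotate p xs") auto
qed simp

lemma length_filter_rotate: "length (filter P (rotate p xs)) = length (filter P xs)"
proof (induction p)
  case (Suc p)
  then show ?case
    by (cases "rotate p xs") auto
qed simp

text \<open>Let \<open>S i\<close> be \<open>i\<close> minus the total rise of the first
  \<open>i\<close> blocks of \<open>m\<close> columns. A first hit from block \<open>r\<close> means
  that \<open>S\<close> first gains \<open>c\<close> after \<open>n\<close> blocks, and each block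
  raises \<open>S\<close> by at most 1, as \<open>records_per_period\<close> requires.\<close>

lemma card_first_hit_rotations:
  assumes "m > 0" "n > 0" "length cs = m * n" "n = c + height cs"
  shows "card {r. r < n \<and> first_hit m (m * c) (rotate (m * r) cs)} = c"
proof -
  let ?L = "m * n"
  \<comment> \<open>\<open>F\<close> sums rises along the periodic extension of \<open>cs\<close>,
    so that a rotation becomes a shift of the argument.\<close>
  define F where "F p = (\<Sum>j<p. rise (cs ! (j mod ?L)))" for p
  have "?L > 0"
    using assms by simp
  have F_add: "F (p + q) = F p + (\<Sum>j<q. rise (cs ! ((p + j) mod ?L)))" for p q
    unfolding F_def by (induction q) (auto simp: algebra_simps)
  have height_rotate: "F (p + q) = F p + height (take q (rotate p cs))" if "q \<le> ?L" for p q
  proof -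
    have "height (take q (rotate p cs)) = (\<Sum>j<q. rise (rotate p cs ! j))"
      using that assms(3) by (simp add: sum_list_sum_nth atLeast0LessThan)
    also have "\<dots> = (\<Sum>j<q. rise (cs ! ((p + j) mod ?L)))"
      using that assms(3) by (intro sum.cong) (auto simp: nth_rotate)
    finally show ?thesis
      by (simp add: F_add)
  qed
  have height_eq: "height (rotate p cs) = height cs" for p
    by (rule sum_list_rotate)
  define S where "S i = int i - int (F (m * i))" for i
  have "card {r. r < n \<and> (\<forall>i<n. S (r + i) < S r + int c)} = c"
  proof (rule records_per_period)
    fix i
    have "F (m * i + ?L) = F (m * i) + height cs"
      using height_rotate[of ?L "m * i"] height_eq[of "m * i"] assms(3) by simp
    then show "S (i + n) = S i + int c"
      using assms(4) by (simp add: S_def algebra_simps)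
    have "F (m * i) \<le> F (m * Suc i)"
      using F_add[of "m * i" m] by (simp add: algebra_simps)
    then show "S (Suc i) \<le> S i + 1"
      by (simp add: S_def)
  qed (use assms in auto)
  moreover have "first_hit m (m * c) (rotate (m * r) cs) \<longleftrightarrow> (\<forall>i<n. S (r + i) < S r + int c)" for r
  proof -
    have "i < c + height (take (m * i) (rotate (m * r) cs)) \<longleftrightarrow> S (r + i) < S r + int c"
      if "i < n" for i
    proof -
      have "m * i \<le> ?L"
        using that by simp
      from height_rotate[OF this, of "m * r"] show ?thesis
        by (simp add: S_def algebra_simps) linarith
    qed
    then show ?thesis
      using first_hit_blocks[of m "rotate (m * r) cs" n c] assms height_eq by auto
  qed
  ultimately show ?thesis
    by simp
qed

text \<open>Double counting of pairs of a list and a rotation: each list has \<open>c\<close> good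
  rotations, and each rotation permutes \<open>X\<close>, hence makes as many lists good as the
  identity does. Lists with a rotational symmetry are covered by the same count.\<close>

lemma rotation_closed_card:
  assumes "m > 0" "n > 0" "finite X"
    and X: "\<And>cs. cs \<in> X \<Longrightarrow> length cs = m * n \<and> n = c + height cs"
    and closed: "\<And>cs. cs \<in> X \<Longrightarrow> rotate m cs \<in> X"
  shows "n * card {cs \<in> X. first_hit m (m * c) cs} = c * card X"
proof -
  have closed_pow: "rotate (m * r) cs \<in> X" if "cs \<in> X" for r cs
    using that
  proof (induction r)
    case (Suc r)
    then show ?case
      using closed[of "rotate (m * r) cs"] by (simp add: rotate_rotate)
  qed simp
  have rotate_inj: "inj_on (rotate p) X" for p
    by (metis inj_fn inj_rotate1 inj_on_subset rotate_def subset_UNIV)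
  have rotate_X: "rotate (m * r) ` X = X" for r
    using closed_pow rotate_inj \<open>finite X\<close> by (intro endo_inj_surj) auto
  have fixed_r: "card {cs \<in> X. first_hit m (m * c) (rotate (m * r) cs)}
      = card {cs \<in> X. first_hit m (m * c) cs}" for r
  proof -
    let ?H = "first_hit m (m * c)"
    have "{cs \<in> rotate (m * r) ` X. ?H cs} = rotate (m * r) ` {cs \<in> X. ?H (rotate (m * r) cs)}"
      by auto
    moreover have "inj_on (rotate (m * r)) {cs \<in> X. ?H (rotate (m * r) cs)}"
      using rotate_inj by (rule inj_on_subset) auto
    ultimately show ?thesis
      by (simp only: rotate_X card_image)
  qed
  have "c * card X = (\<Sum>cs\<in>X. card {r \<in> {..<n}. first_hit m (m * c) (rotate (m * r) cs)})"
    using card_first_hit_rotations[OF assms(1,2)] X by simp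
  also have "\<dots> = (\<Sum>r<n. card {cs \<in> X. first_hit m (m * c) (rotate (m * r) cs)})"
    using \<open>finite X\<close> by (intro sum_multicount_gen) auto
  also have "\<dots> = n * card {cs \<in> X. first_hit m (m * c) cs}"
    by (simp add: fixed_r)
  finally show ?thesis
    by simp
qed

section \<open>Counting columns\<close>

text \<open>Column \<open>j\<close>, counted from 0, ends at x-coordinate
  \<open>Suc j\<close>.\<close>

definition diags_on :: "nat \<Rightarrow> column list \<Rightarrow> bool" where
  "diags_on e cs \<longleftrightarrow> (\<forall>j<length cs. snd (cs ! j) \<longrightarrow> e dvd Suc j)"

definition columns :: "nat \<Rightarrow> nat \<Rightarrow> nat \<Rightarrow> nat \<Rightarrow> column list set" where
  "columns e L a d = {cs. length cs = L \<and> diags_on e cs \<and>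
     sum_list (map fst cs) = a \<and> length (filter snd cs) = d}"

lemma height_eq: "height cs = sum_list (map fst cs) + length (filter snd cs)"
  by (induction cs) (auto simp: rise_def)

text \<open>North steps and diagonals are chosen independently: a weak composition of
  \<open>a\<close> into \<open>L\<close> parts and a \<open>d\<close>-subset of the admissible
  columns.\<close>

lemma bij_columns:
  "bij_betw (\<lambda>cs. (map fst cs, {j. j < L \<and> snd (cs ! j)})) (columns e L a d)
     ({ks. length ks = L \<and> sum_list ks = a} \<times> {B. B \<subseteq> {j. j < L \<and> e dvd Suc j} \<and> card B = d})"
  (is "bij_betw ?f ?X ?Y")
proof (rule bij_betw_byWitness[where f' = "\<lambda>(ks, B). map (\<lambda>j. (ks ! j, j \<in> B)) [0..<L]"])
  show "\<forall>cs\<in>?X. (\<lambda>(ks, B). map (\<lambda>j. (ks ! j, j \<in> B)) [0..<L]) (?f cs) = cs"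
    by (auto simp: columns_def intro!: nth_equalityI prod_eqI)
  show "\<forall>y\<in>?Y. ?f ((\<lambda>(ks, B). map (\<lambda>j. (ks ! j, j \<in> B)) [0..<L]) y) = y"
    by (auto simp: comp_def map_nth intro: nth_equalityI)
  show "?f ` ?X \<subseteq> ?Y"
    by (auto simp: columns_def diags_on_def length_filter_conv_card)
  show "(\<lambda>(ks, B). map (\<lambda>j. (ks ! j, j \<in> B)) [0..<L]) ` ?Y \<subseteq> ?X"
  proof clarify
    fix ks :: "nat list" and B
    assume B: "B \<subseteq> {j. j < length ks \<and> e dvd Suc j}"
    then have "{j. j < length ks \<and> j \<in> B} = B"
      by auto
    with B show "map (\<lambda>j. (ks ! j, j \<in> B)) [0..<length ks] \<in> columns e (length ks) (sum_list ks) (card B)"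
      by (auto simp: columns_def diags_on_def length_filter_conv_card comp_def map_nth cong: conj_cong)
  qed
qed

lemma card_multiples: "card {j. j < e * q \<and> e dvd Suc j} = q" if "e > 0" for e q :: nat
proof -
  \<comment> \<open>The admissible indices are the last ones of the \<open>q\<close> blocks of
    \<open>e\<close> consecutive columns.\<close>
  have "{j. j < e * q \<and> e dvd Suc j} = (\<lambda>i. e * Suc i - 1) ` {..<q}"
  proof (intro set_eqI iffI)
    fix j assume "j \<in> {j. j < e * q \<and> e dvd Suc j}"
    then obtain i where i: "Suc j = e * i" and "j < e * q"
      by (auto elim: dvdE)
    then have "e * i \<le> e * q"
      by (metis Suc_leI)
    have "i > 0"
      using i by (auto intro: gr0I)
    from \<open>e * i \<le> e * q\<close> have "i \<le> q"
      using that by (metis nat_mult_le_cancel1)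
    then show "j \<in> (\<lambda>i. e * Suc i - 1) ` {..<q}"
      using i \<open>i > 0\<close> by (intro image_eqI[of _ _ "i - 1"]) auto
  next
    fix j assume "j \<in> (\<lambda>i. e * Suc i - 1) ` {..<q}"
    then obtain i where i: "j = e * Suc i - 1" "i < q"
      by auto
    then have "Suc j = e * Suc i"
      using that by simp
    moreover have "e * Suc i \<le> e * q"
      using i by (intro mult_le_mono2) simp
    ultimately show "j \<in> {j. j < e * q \<and> e dvd Suc j}"
      by (metis (mono_tags, lifting) Suc_le_eq dvd_triv_left mem_Collect_eq)
  qed
  moreover have "inj_on (\<lambda>i. e * Suc i - 1) {..<q}"
  proof (rule inj_onI)
    fix i k assume "e * Suc i - 1 = e * Suc k - 1"
    moreover have "e * Suc i > 0" "e * Suc k > 0"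
      using that by auto
    ultimately have "e * Suc i = e * Suc k"
      by linarith
    then show "i = k"
      using that by simp
  qed
  ultimately show ?thesis
    by (simp add: card_image)
qed

text \<open>Stars and bars give the factor for the north steps.\<close>

lemma finite_columns: "finite (columns e L a d)"
  and card_columns:
    "card (columns e L a d) = ((L + a - 1) choose a) * (card {j. j < L \<and> e dvd Suc j} choose d)"
proof -
  let ?K = "{ks :: nat list. length ks = L \<and> sum_list ks = a}"
  let ?B = "{B. B \<subseteq> {j. j < L \<and> e dvd Suc j} \<and> card B = d}"
  have "?K \<subseteq> {ks. set ks \<subseteq> {..a} \<and> length ks = L}"
    using member_le_sum_list by fastforce
  then have "finite ?K"
    by (rule finite_subset) (rule finite_lists_length_eq, simp)
  moreover have "finite ?B"
    by simp
  ultimately show "finite (columns e L a d)"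
    using bij_betw_finite[OF bij_columns] by blast
  have "card (columns e L a d) = card (?K \<times> ?B)"
    by (rule bij_betw_same_card[OF bij_columns])
  then show "card (columns e L a d) = ((L + a - 1) choose a) * (card {j. j < L \<and> e dvd Suc j} choose d)"
    by (simp add: card_cartesian_product card_length_sum_list n_subsets add.commute)
qed

text \<open>Shifting indices by \<open>m\<close>, a multiple of \<open>e\<close>, keeps their
  residues modulo \<open>e\<close>, and so does wrapping around at \<open>m * n\<close>.\<close>

lemma rotate_columns:
  assumes "e dvd m" "cs \<in> columns e (m * n) a d"
  shows "rotate m cs \<in> columns e (m * n) a d"
proof -
  have len: "length cs = m * n"
    using assms by (simp add: columns_def)
  have "diags_on e (rotate m cs)"
    unfolding diags_on_def
  proof (intro allI impI)
    fix j assume j: "j < length (rotate m cs)" "snd (rotate m cs ! j)"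
    let ?j = "(m + j) mod (m * n)"
    have "?j < m * n"
      using j len by (metis length_rotate mod_less_divisor not_less_zero not_gr_zero)
    then have "e dvd Suc ?j"
      using assms(2) j len by (auto simp: columns_def diags_on_def nth_rotate)
    have "Suc (m + j) = Suc ?j + m * n * ((m + j) div (m * n))"
      by simp
    moreover have "e dvd m * n * ((m + j) div (m * n))"
      using \<open>e dvd m\<close> by simp
    ultimately have "e dvd Suc (m + j)"
      using \<open>e dvd Suc ?j\<close> by (metis dvd_add)
    then show "e dvd Suc j"
      using \<open>e dvd m\<close> by (metis add_Suc_right dvd_add_right_iff)
  qed
  then show ?thesis
    using assms(2) by (simp add: columns_def sum_list_rotate length_filter_rotate)
qed

section \<open>Words\<close>

text \<open>The starting point \<open>(x, y)\<close> is a parameter to allow induction on the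
  steps.\<close>

definition stays :: "nat \<Rightarrow> nat \<Rightarrow> nat \<Rightarrow> step list \<Rightarrow> bool" where
  "stays m x y w \<longleftrightarrow>
     (\<forall>k\<le>length w. x + fst (point w k) \<le> m * (y + snd (point w k))) \<and>
     (\<forall>i<length w. w ! i = Diag \<longrightarrow> x + fst (point w i) \<noteq> m * (y + snd (point w i)))"

text \<open>Positions rather than points are counted, and the last one is left out: a path ends on
  the line without this being a return.\<close>

definition touches :: "nat \<Rightarrow> nat \<Rightarrow> nat \<Rightarrow> step list \<Rightarrow> nat" where
  "touches m x y w = card {k. k < length w \<and> x + fst (point w k) = m * (y + snd (point w k))}"

definition divisible_from :: "nat \<Rightarrow> nat \<Rightarrow> step list \<Rightarrow> bool" where
  "divisible_from e x w \<longleftrightarrow> (\<forall>i<length w. w ! i = Diag \<longrightarrow> e dvd x + fst (point w (Suc i)))"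

section \<open>Recursion along a word\<close>

lemma point_0 [simp]: "point w 0 = (0, 0)"
  by (simp add: point_def)

lemma point_Cons_Suc [simp]:
  "point (s # w) (Suc k) = (fst (step_vec s) + fst (point w k), snd (step_vec s) + snd (point w k))"
  by (simp add: point_def)

lemma point_Suc:
  "k < length w \<Longrightarrow> point w (Suc k) =
     (fst (point w k) + fst (step_vec (w ! k)), snd (point w k) + snd (step_vec (w ! k)))"
  by (simp add: point_def take_Suc_conv_app_nth)

lemma point_split:
  assumes "j \<le> k"
  shows "point w k = (fst (point w j) + fst (point (drop j w) (k - j)),
    snd (point w j) + snd (point (drop j w) (k - j)))"
proof -
  have "take k w = take j w @ take (k - j) (drop j w)"
    using assms by (metis le_add_diff_inverse take_add)
  then show ?thesis
    by (simp add: point_def)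
qed

text \<open>Every step increases the sum of the coordinates. Hence points of a path can be counted
  by their positions in the word.\<close>

lemma point_inj:
  assumes "j < k" "k \<le> length w"
  shows "point w j \<noteq> point w k"
proof -
  obtain s u where su: "drop j w = s # u"
    using assms by (metis Cons_nth_drop_Suc order_less_le_trans)
  obtain i where i: "k - j = Suc i"
    using assms by (metis Suc_diff_Suc)
  have "fst (step_vec s) + snd (step_vec s) > 0"
    by (cases s) auto
  then have "fst (point (drop j w) (k - j)) + snd (point (drop j w) (k - j)) > 0"
    by (auto simp: su i)
  then show ?thesis
    using point_split[of j k w] assms by (auto simp: prod_eq_iff)
qed

lemma stays_Nil [simp]: "stays m x y [] \<longleftrightarrow> x \<le> m * y"
  by (simp add: stays_def)

lemma stays_Cons:
  "stays m x y (s # w) \<longleftrightarrow> x \<le> m * y \<and> (s = Diag \<longrightarrow> x \<noteq> m * y) \<and>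
     stays m (x + fst (step_vec s)) (y + snd (step_vec s)) w"
proof -
  have "(\<forall>k\<le>Suc (length w). P k) \<longleftrightarrow> P 0 \<and> (\<forall>k\<le>length w. P (Suc k))" for P
    by (simp flip: less_Suc_eq_le add: All_less_Suc2)
  then show ?thesis
    by (auto simp: stays_def All_less_Suc2 add.assoc)
qed

lemma touches_Nil [simp]: "touches m x y [] = 0"
  by (simp add: touches_def)

lemma touches_Cons:
  "touches m x y (s # w) =
     of_bool (x = m * y) + touches m (x + fst (step_vec s)) (y + snd (step_vec s)) w"
proof -
  let ?A = "{k. k < length w \<and> x + fst (step_vec s) + fst (point w k)
    = m * (y + snd (step_vec s) + snd (point w k))}"
  have "{k. k < length (s # w) \<and> x + fst (point (s # w) k) = m * (y + snd (point (s # w) k))}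
      = (if x = m * y then {0} else {}) \<union> Suc ` ?A" (is "?L = ?R")
  proof (rule set_eqI)
    fix k show "k \<in> ?L \<longleftrightarrow> k \<in> ?R"
      by (cases k) (auto simp: add.assoc)
  qed
  moreover have "card (Suc ` ?A) = card ?A"
    by (simp add: card_image)
  moreover have "finite (Suc ` ?A)"
    by simp
  ultimately show ?thesis
    by (auto simp: touches_def)
qed

lemma divisible_from_Nil [simp]: "divisible_from e x []"
  by (simp add: divisible_from_def)

lemma divisible_from_Cons:
  "divisible_from e x (s # w) \<longleftrightarrow>
     (s = Diag \<longrightarrow> e dvd Suc x) \<and> divisible_from e (x + fst (step_vec s)) w"
  by (auto simp: divisible_from_def All_less_Suc2 add.assoc)

text \<open>North steps lead away from the line, so their start is the only point to test.\<close>

lemma stays_replicate_North: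
  "x \<le> m * y \<Longrightarrow> stays m x y (replicate k North @ w) \<longleftrightarrow> stays m x (y + k) w"
proof (induction k arbitrary: y)
  case (Suc k)
  have "x \<le> m * Suc y"
    using Suc.prems by simp
  from Suc.IH[OF this] Suc.prems show ?case
    by (simp add: stays_Cons)
qed simp

lemma touches_replicate_North:
  "m > 0 \<Longrightarrow> x < m * y \<Longrightarrow> touches m x y (replicate k North @ w) = touches m x (y + k) w"
proof (induction k arbitrary: y)
  case (Suc k)
  have "x < m * Suc y"
    using Suc.prems by simp
  from Suc.IH[OF \<open>m > 0\<close> this] Suc.prems show ?case
    by (simp add: touches_Cons)
qed simp

lemma touches_replicate_North_pos:
  assumes "m > 0" "x \<le> m * y" "k > 0"
  shows "touches m x y (replicate k North @ w) = of_bool (x = m * y) + touches m x (y + k) w"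
proof -
  obtain k' where "k = Suc k'"
    using \<open>k > 0\<close> gr0_conv_Suc by blast
  moreover have "x < m * Suc y"
    using assms by simp
  ultimately show ?thesis
    using touches_replicate_North[of m x "Suc y" k' w] \<open>m > 0\<close> by (simp add: touches_Cons)
qed

lemma divisible_from_replicate_North:
  "divisible_from e x (replicate k North @ w) \<longleftrightarrow> divisible_from e x w"
  by (induction k) (auto simp: divisible_from_Cons)

lemma point_append_length:
  "point (u @ v) (length (u @ v)) =
     (fst (point u (length u)) + fst (point v (length v)), snd (point u (length u)) + snd (point v (length v)))"
  by (simp add: point_def)

lemma point_replicate_North: "point (replicate k North) k = (0, k)"
  by (simp add: point_def sum_list_replicate)

lemma point_word: "point (word cs) (length (word cs)) = (length cs, height cs)"
proof (induction cs)
  case (Cons c cs)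
  obtain k s where c: "c = (k, s)"
    by (cases c)
  have "point (col_word c) (length (col_word c)) = (1, rise c)"
    by (simp add: c point_def sum_list_replicate rise_def)
  then show ?case
    using Cons point_append_length[of "col_word c" "word cs"] by simp
qed simp

lemma num_diag_word: "num_diag (word cs) = length (filter snd cs)"
proof (induction cs)
  case (Cons c cs)
  have "count_list (replicate k North) Diag = 0" for k
    by (simp add: count_list_0_iff)
  then show ?case
    using Cons by (cases c) (auto simp: num_diag_def)
qed (simp add: num_diag_def)

lemma divisible_from_word:
  "divisible_from e x (word cs) \<longleftrightarrow> (\<forall>j<length cs. snd (cs ! j) \<longrightarrow> e dvd x + Suc j)"
proof (induction cs arbitrary: x)
  case (Cons c cs)
  obtain k s where c: "c = (k, s)"
    by (cases c)
  have "divisible_from e x (word (c # cs)) \<longleftrightarrow> (s \<longrightarrow> e dvd Suc x) \<and> divisible_from e (Suc x) (word cs)"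
    by (simp add: c divisible_from_replicate_North divisible_from_Cons)
  then show ?case
    by (simp add: Cons.IH c All_less_Suc2)
qed simp

text \<open>The level is \<open>m * y - x\<close>, an exact subtraction as
  \<open>x \<le> m * y\<close>. A column changes it by \<open>m * rise c - 1\<close> and, on a path
  that stays above, begins at the only point before its end where it can meet the line. So
  \<open>touches\<close> agrees with the test \<open>z = 0\<close>.\<close>

lemma path_cols_iff:
  assumes "m > 0" "x \<le> m * y"
  shows "path_cols m (m * y - x) b cs \<longleftrightarrow>
    stays m x y (word cs) \<and> x + length cs = m * (y + height cs) \<and> touches m x y (word cs) = b"
  using assms(2)
proof (induction cs arbitrary: x y b)
  case (Cons c cs)
  obtain k s where c: "c = (k, s)"
    by (cases c)
  let ?y = "y + rise c"
  let ?st = "if s then Diag else East"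
  have word: "word (c # cs) = replicate k North @ ?st # word cs"
    by (simp add: c)
  have vec: "step_vec ?st = (1, of_bool s)"
    by simp
  have rise: "rise c = k + of_bool s"
    by (simp add: c rise_def)
  have stays: "stays m x y (word (c # cs)) \<longleftrightarrow>
      (s \<longrightarrow> x \<noteq> m * (y + k)) \<and> stays m (Suc x) ?y (word cs)"
    unfolding word stays_replicate_North[OF Cons.prems] stays_Cons vec
    using Cons.prems by (auto simp: rise add.assoc algebra_simps)
  have touch_tail: "touches m x y (?st # word cs) = of_bool (x = m * y) + touches m (Suc x) (y + of_bool s) (word cs)" for y
    unfolding touches_Cons vec by simp
  show ?case
  proof (cases "x = m * y")
    case True
    show ?thesis
    proof (cases "k = 0")
      case k: True
      \<comment> \<open>Without a north step the column would cross the line by an east step or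
        begin a diagonal on it.\<close>
      have "\<not> stays m x y (word (c # cs))"
      proof (cases s)
        case False
        then have "\<not> stays m (Suc x) ?y (word cs)"
          using True k by (auto simp: stays_def rise)
        then show ?thesis
          unfolding stays by simp
      next
        case True
        then show ?thesis
          unfolding stays using \<open>x = m * y\<close> k by simp
      qed
      then show ?thesis
        using True k by (simp add: c)
    next
      case False
      then have less: "x < m * (y + k)"
        using True \<open>m > 0\<close> by simp
      then have le: "Suc x \<le> m * ?y"
        by (simp add: rise algebra_simps)
      have touches: "touches m x y (word (c # cs)) = Suc (touches m (Suc x) ?y (word cs))"
        unfolding word touches_replicate_North_pos[OF \<open>m > 0\<close> Cons.prems False[unfolded neq0_conv]] touch_tail
        using True less by (simp add: rise add.assoc)
      have level: "m * ?y - Suc x = m * rise c - 1"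
        using True by (simp add: algebra_simps)
      have end_iff: "x + length (c # cs) = m * (y + height (c # cs)) \<longleftrightarrow>
          Suc x + length cs = m * (?y + height cs)"
        by (simp add: add.assoc)
      have "path_cols m (m * y - x) b (c # cs) \<longleftrightarrow> b > 0 \<and> path_cols m (m * rise c - 1) (b - 1) cs"
        using True False by (simp add: c)
      then show ?thesis
        unfolding stays touches end_iff using Cons.IH[OF le, of "b - 1"] True less
        unfolding level by auto
    qed
  next
    case False
    then have "x < m * y"
      using Cons.prems by simp
    then have less: "x < m * (y + k)"
      by (simp add: algebra_simps)
    then have le: "Suc x \<le> m * ?y"
      by (simp add: rise algebra_simps)
    have touches: "touches m x y (word (c # cs)) = touches m (Suc x) ?y (word cs)"
      unfolding word touches_replicate_North[OF \<open>m > 0\<close> \<open>x < m * y\<close>]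
      using less by (simp add: touch_tail rise add.assoc)
    have level: "m * ?y - Suc x = m * y - x + m * rise c - 1"
      using \<open>x < m * y\<close> by (simp add: algebra_simps)
    have end_iff: "x + length (c # cs) = m * (y + height (c # cs)) \<longleftrightarrow>
        Suc x + length cs = m * (?y + height cs)"
      by (simp add: add.assoc)
    have "path_cols m (m * y - x) b (c # cs) \<longleftrightarrow> path_cols m (m * y - x + m * rise c - 1) b cs"
      using \<open>x < m * y\<close> by simp
    then show ?thesis
      unfolding stays touches end_iff using Cons.IH[OF le, of b] less
      unfolding level by auto
  qed
qed (auto)

section \<open>Unique decomposition of words into columns\<close>

lemma word_exists: "w = [] \<or> last w \<noteq> North \<Longrightarrow> \<exists>cs. w = word cs"
proof (induction w)
  case Nil
  then show ?case
    by (intro exI[of _ "[]"]) simp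
next
  case (Cons s w)
  show ?case
  proof (cases "s = North")
    case True
    then have "w \<noteq> []" "last w \<noteq> North"
      using Cons.prems by (auto split: if_splits)
    then obtain cs where cs: "w = word cs"
      using Cons.IH by blast
    with \<open>w \<noteq> []\<close> obtain k s' cs' where "cs = (k, s') # cs'"
      by (cases cs) auto
    then show ?thesis
      using True cs by (intro exI[of _ "(Suc k, s') # cs'"]) simp
  next
    case False
    have "w = [] \<or> last w \<noteq> North"
      using Cons.prems by auto
    then obtain cs where cs: "w = word cs"
      using Cons.IH by blast
    have "s = (if s = Diag then Diag else East)"
      using False by (cases s) auto
    then show ?thesis
      using cs by (intro exI[of _ "(0, s = Diag) # cs"]) simp
  qed
qed

lemma replicate_append_Cons_inject:
  assumes "replicate k a @ s # u = replicate l a @ s' # v" "s \<noteq> a" "s' \<noteq> a"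
  shows "k = l \<and> s = s' \<and> u = v"
  using assms(1)
proof (induction k arbitrary: l)
  case 0
  then show ?case using assms(2) by (cases l) auto
next
  case (Suc k)
  then show ?case using assms(3) by (cases l) auto
qed

lemma word_inject: "word cs = word cs' \<Longrightarrow> cs = cs'"
proof (induction cs arbitrary: cs')
  case Nil
  then show ?case by (cases cs') auto
next
  case (Cons c cs)
  obtain k s where c: "c = (k, s)"
    by (cases c)
  obtain l s' ds where cs': "cs' = (l, s') # ds"
    using Cons.prems c by (cases cs') auto
  have "replicate k North @ (if s then Diag else East) # word cs
      = replicate l North @ (if s' then Diag else East) # word ds"
    using Cons.prems by (simp add: c cs')
  moreover have "(if p then Diag else East) \<noteq> North" for p
    by simp
  ultimately have "k = l \<and> s = s' \<and> word cs = word ds"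
    using replicate_append_Cons_inject
    by (metis step.distinct(5))
  then show ?case
    using Cons.IH c cs' by auto
qed

section \<open>Small Schroeder paths\<close>

text \<open>The initial climb stays above the line and has no diagonals, so only the remainder has
  to be tested, from \<open>(0, t)\<close>.\<close>

lemma small_schroeder_iff:
  "small_schroeder m t n w \<longleftrightarrow>
     (\<exists>w'. w = replicate t North @ w' \<and> stays m 0 t w' \<and> point w (length w) = (m * n, n))"
proof -
  have "t \<le> length w \<and> (\<forall>i<t. w ! i = North) \<longleftrightarrow> (\<exists>w'. w = replicate t North @ w')"
  proof
    assume "t \<le> length w \<and> (\<forall>i<t. w ! i = North)"
    then have "take t w = replicate t North"
      by (auto intro: nth_equalityI)
    then show "\<exists>w'. w = replicate t North @ w'"
      by (metis append_take_drop_id)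
  qed (auto simp: nth_append)
  then have "small_schroeder m t n w \<longleftrightarrow>
      (\<exists>w'. w = replicate t North @ w') \<and> stays m 0 0 w \<and> point w (length w) = (m * n, n)"
    unfolding small_schroeder_def stays_def by auto
  then show ?thesis
    by (auto simp: stays_replicate_North)
qed

text \<open>From above, the line is reached by an east step only: a north step would come from below
  it, and so would a diagonal, or else, for \<open>m = 1\<close>, from a point on the line, where no
  diagonal starts. Likewise only a north step can leave it.\<close>

lemma return_neighbours:
  assumes "m > 0" and stays: "stays m 0 0 w" and "k < length w" "k > 0"
    and touch: "fst (point w k) = m * snd (point w k)"
  shows "w ! (k - 1) = East \<and> w ! k = North"
proof
  have below: "fst (point w i) \<le> m * snd (point w i)" if "i \<le> length w" for i
    using stays that by (simp add: stays_def)
  have diag: "w ! i = Diag \<Longrightarrow> fst (point w i) \<noteq> m * snd (point w i)" if "i < length w" for i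
    using stays that by (simp add: stays_def)
  obtain i where k: "k = Suc i"
    using \<open>k > 0\<close> gr0_conv_Suc by blast
  then have i: "i < length w"
    using assms by simp
  show "w ! (k - 1) = East"
    using point_Suc[OF i] below[of i] diag[OF i] touch i \<open>m > 0\<close> k
    by (cases "w ! i") auto
  show "w ! k = North"
    using point_Suc[OF \<open>k < length w\<close>] below[of "Suc k"] diag[OF \<open>k < length w\<close>] touch \<open>k < length w\<close>
    by (cases "w ! k") auto
qed

text \<open>Interior visits to the line are valleys by \<open>return_neighbours\<close>, and
  distinct positions give distinct points by \<open>point_inj\<close>.\<close>

lemma card_returns:
  assumes "m > 0" and stays: "stays m 0 0 w" and final: "point w (length w) = (m * n, n)"
  shows "card (returns m n w) = card {k. k > 0 \<and> k < length w \<and> fst (point w k) = m * snd (point w k)}"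
proof -
  let ?K = "{k. k > 0 \<and> k < length w \<and> fst (point w k) = m * snd (point w k)}"
  have "returns m n w = point w ` ?K"
  proof (intro equalityI subsetI)
    fix v assume "v \<in> returns m n w"
    then obtain i k where "Suc i < length w" "v = point w (Suc i)" "v = (m * k, k)"
      by (auto simp: returns_def valleys_def)
    then show "v \<in> point w ` ?K"
      by (intro image_eqI[of _ _ "Suc i"]) (auto simp: prod_eq_iff)
  next
    fix v assume "v \<in> point w ` ?K"
    then obtain k where k: "k > 0" "k < length w" "fst (point w k) = m * snd (point w k)"
      and v: "v = point w k"
      by auto
    have steps: "w ! (k - 1) = East" "w ! k = North"
      using return_neighbours[OF assms(1) stays k(2,1,3)] by auto
    then have "v \<in> valleys w"
      using k v unfolding valleys_def by (auto intro!: exI[of _ "k - 1"])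
    \<comment> \<open>The east step before the point and the north step after it give the bounds 1
      and \<open>n - 1\<close> on its height.\<close>
    have "fst (point w k) = Suc (fst (point w (k - 1)))"
      using point_Suc[of "k - 1" w] k(1,2) steps(1) by simp
    then have "snd (point w k) > 0"
      using k(3) by (cases "snd (point w k)") auto
    have "snd (point w (Suc k)) = Suc (snd (point w k))"
      using point_Suc[of k w] k steps by simp
    moreover have "snd (point w (Suc k)) \<le> snd (point w (length w))"
      using point_split[of "Suc k" "length w" w] k by simp
    ultimately have "snd (point w k) \<le> n - 1"
      using final by simp
    with \<open>snd (point w k) > 0\<close> have "snd (point w k) \<in> {1..n - 1}"
      by simp
    moreover have "v = (m * snd (point w k), snd (point w k))"
      using k(3) v by (simp add: prod_eq_iff)
    ultimately show "v \<in> returns m n w"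
      using \<open>v \<in> valleys w\<close> unfolding returns_def by blast
  qed
  moreover have "inj_on (point w) ?K"
    by (rule inj_onI) (metis (mono_tags, lifting) linorder_cases less_imp_le mem_Collect_eq point_inj)
  ultimately show ?thesis
    by (simp add: card_image)
qed

text \<open>The additional visit is the one at the origin.\<close>

lemma touches_eq_Suc_card_returns:
  assumes "m > 0" "stays m 0 0 w" "point w (length w) = (m * n, n)" "w \<noteq> []"
  shows "touches m 0 0 w = Suc (card (returns m n w))"
proof -
  let ?K = "{k. k > 0 \<and> k < length w \<and> fst (point w k) = m * snd (point w k)}"
  have "{k. k < length w \<and> fst (point w k) = m * snd (point w k)} = insert 0 ?K"
    using \<open>w \<noteq> []\<close> by auto
  moreover have "finite ?K"
    by (rule finite_subset[of _ "{..<length w}"]) auto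
  ultimately show ?thesis
    by (simp add: touches_def card_returns[OF assms(1-3)])
qed

text \<open>What follows the first \<open>t\<close> north steps is cut into columns; its visits to
  the line before the end are exactly the returns.\<close>

lemma bij_path_cols:
  assumes "m > 0" "n > 0" "t > 0"
  shows "bij_betw (\<lambda>cs. replicate t North @ word cs)
    {cs. length cs = m * n \<and> path_cols m (m * t) b cs \<and> diags_on e cs \<and> length (filter snd cs) = d}
    {w. small_schroeder m t n w \<and> m_divisible e w \<and> card (returns m n w) = b \<and> num_diag w = d}"
    (is "bij_betw ?f ?C ?W")
proof -
  have mem: "?f cs \<in> ?W \<longleftrightarrow> cs \<in> ?C" for cs
  proof -
    have final: "point (?f cs) (length (?f cs)) = (length cs, t + height cs)"
      using point_append_length[of "replicate t North" "word cs"] point_word[of cs]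
      by (simp add: point_replicate_North)
    have "m_divisible e (?f cs) \<longleftrightarrow> divisible_from e 0 (?f cs)"
      by (simp add: m_divisible_def divisible_from_def)
    then have div: "m_divisible e (?f cs) \<longleftrightarrow> diags_on e cs"
      by (simp add: divisible_from_replicate_North divisible_from_word diags_on_def)
    have diag: "num_diag (?f cs) = length (filter snd cs)"
      using num_diag_word[of cs] by (simp add: num_diag_def count_list_0_iff)
    have small: "small_schroeder m t n (?f cs) \<longleftrightarrow>
        stays m 0 t (word cs) \<and> length cs = m * n \<and> t + height cs = n"
      unfolding small_schroeder_iff final by auto
    \<comment> \<open>The visit at the origin is counted from \<open>(0, 0)\<close> but not from
      \<open>(0, t)\<close>, which cancels the \<open>Suc\<close>.\<close>
    have ret: "card (returns m n (?f cs)) = touches m 0 t (word cs)"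
      if "small_schroeder m t n (?f cs)"
    proof -
      have "touches m 0 0 (?f cs) = Suc (card (returns m n (?f cs)))"
        using that \<open>t > 0\<close> final \<open>m > 0\<close>
        by (intro touches_eq_Suc_card_returns) (auto simp: small stays_replicate_North)
      then show ?thesis
        using touches_replicate_North_pos[of m 0 0 t "word cs"] assms by simp
    qed
    have "length cs = m * n \<and> path_cols m (m * t) b cs \<longleftrightarrow>
        small_schroeder m t n (?f cs) \<and> touches m 0 t (word cs) = b"
      using path_cols_iff[of m 0 t b cs] \<open>m > 0\<close> by (auto simp: small)
    then show ?thesis
      using div diag ret by auto
  qed
  have "inj ?f"
    by (rule injI) (auto dest: word_inject)
  then have "inj_on ?f ?C"
    by (rule inj_on_subset) simp
  moreover have "?f ` ?C = ?W"
  proof (intro equalityI subsetI)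
    fix w assume "w \<in> ?f ` ?C"
    then show "w \<in> ?W" using mem by blast
  next
    fix w assume w: "w \<in> ?W"
    then obtain w' where w': "w = replicate t North @ w'" "stays m 0 t w'"
      and final: "point w (length w) = (m * n, n)"
      by (auto simp: small_schroeder_iff)
    \<comment> \<open>A final north step would start at \<open>(m * n, n - 1)\<close>, on the wrong
      side of the line.\<close>
    have "w' = [] \<or> last w' \<noteq> North"
    proof (rule ccontr)
      assume "\<not> ?thesis"
      then obtain u where u: "w' = u @ [North]"
        by (metis append_butlast_last_id)
      have "point w' (length u) = point u (length u)"
        by (simp add: u point_def)
      moreover have "fst (point w' (length u)) \<le> m * (t + snd (point w' (length u)))"
        using w'(2) by (simp add: stays_def u)
      ultimately have "fst (point u (length u)) \<le> m * (t + snd (point u (length u)))"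
        by simp
      moreover have "point [North] (length [North]) = (0, 1)"
        by (simp add: point_def)
      then have "point w (length w) = (fst (point u (length u)), t + snd (point u (length u)) + 1)"
        using point_append_length[of "replicate t North" w'] point_append_length[of u "[North]"]
        by (simp add: w'(1) u point_replicate_North)
      ultimately have "m * n \<le> m * (n - 1)"
        using final by auto
      then show False
        using assms by simp
    qed
    then obtain cs where "w' = word cs"
      using word_exists by blast
    then show "w \<in> ?f ` ?C"
      using w w'(1) mem by blast
  qed
  ultimately show ?thesis
    by (simp add: bij_betw_def)
qed

text \<open>Both maps change only numbers of north steps, so the diagonals keep their
  columns.\<close>

lemma bij_lower:
  assumes "m > 0" "a + b + d + t = n"
  shows "bij_betw (lower m (m * t))
    {cs. length cs = m * n \<and> path_cols m (m * t) b cs \<and> diags_on e cs \<and> length (filter snd cs) = d}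
    {cs \<in> columns e (m * n) a d. first_hit m (m * (t + b)) cs}"
    (is "bij_betw _ ?C ?G")
proof -
  have cong: "length cs = length ds \<and> (diags_on e cs \<longleftrightarrow> diags_on e ds)
      \<and> length (filter snd cs) = length (filter snd ds)" if "map snd cs = map snd ds"
    for cs ds :: "column list"
  proof -
    have len: "length cs = length ds"
      using that by (metis length_map)
    moreover have "snd (cs ! j) = snd (ds ! j)" if "j < length cs" for j
      using that len \<open>map snd cs = map snd ds\<close> by (metis nth_map)
    ultimately show ?thesis
      by (auto simp: diags_on_def length_filter_conv_card cong: conj_cong)
  qed
  have lower: "length (lower m z cs) = length cs \<and> (diags_on e (lower m z cs) \<longleftrightarrow> diags_on e cs)
      \<and> length (filter snd (lower m z cs)) = length (filter snd cs)" for z cs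
    by (rule cong) (rule map_snd_lower)
  have lift: "length (lift m z cs) = length cs \<and> (diags_on e (lift m z cs) \<longleftrightarrow> diags_on e cs)
      \<and> length (filter snd (lift m z cs)) = length (filter snd cs)" for z cs
    by (rule cong) (rule map_snd_lift)
  \<comment> \<open>A first hit forces the total height \<open>n - (t + b)\<close>; diagonals
    account for \<open>d\<close> of it and north steps for the remaining \<open>a\<close>.\<close>
  have sum_fst: "sum_list (map fst cs) = a"
    if "first_hit m (m * (t + b)) cs" "length cs = m * n" "length (filter snd cs) = d" for cs
    using that first_hit_blocks[of m cs n "t + b"] assms by (simp add: height_eq)
  show ?thesis
  proof (rule bij_betw_byWitness[where f' = "lift m (m * t)"])
    show "\<forall>cs\<in>?C. lift m (m * t) (lower m (m * t) cs) = cs"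
      using lower_path_cols[OF \<open>m > 0\<close>] by blast
    show "\<forall>cs\<in>?G. lower m (m * t) (lift m (m * t) cs) = cs"
      using lift_first_hit[OF \<open>m > 0\<close>] by (auto simp: add_mult_distrib2)
    show "lower m (m * t) ` ?C \<subseteq> ?G"
    proof clarify
      fix cs assume cs: "length cs = m * n" "path_cols m (m * t) b cs" "diags_on e cs"
        "d = length (filter snd cs)"
      have "first_hit m (m * (t + b)) (lower m (m * t) cs)"
        using lower_path_cols[OF \<open>m > 0\<close> cs(2)] by (simp add: add_mult_distrib2)
      then show "lower m (m * t) cs \<in> columns e (m * n) a (length (filter snd cs))
          \<and> first_hit m (m * (t + b)) (lower m (m * t) cs)"
        using lower sum_fst cs by (simp add: columns_def)
    qed
    show "lift m (m * t) ` ?G \<subseteq> ?C"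
      using lift lift_first_hit[OF \<open>m > 0\<close>, of "m * t" b]
      by (auto simp: columns_def add_mult_distrib2)
  qed
qed

text \<open>Paths correspond to first-hit lists, which make up the share \<open>(t + b) / n\<close>
  of all column lists; \<open>(m div e) * n\<close> columns admit a diagonal.\<close>

lemma card_small_schroeder:
  assumes "m > 0" "n > 0" "t > 0" "t \<le> n" "a + b \<le> n - t" "e dvd m"
  shows "real (card {w. small_schroeder m t n w \<and> m_divisible e w \<and>
      card (returns m n w) = b \<and> num_diag w = n - t - a - b}) =
    real (t + b) / real n * real ((m * n + a - 1) choose a) *
      real (((m div e) * n) choose (n - t - a - b))"
    (is "real (card ?W) = _")
proof -
  define d where "d = n - t - a - b"
  have sum: "a + b + d + t = n"
    using assms by (simp add: d_def)
  have "e > 0"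
    using assms by (auto intro: gr0I)
  have "m * n = e * ((m div e) * n)"
    using \<open>e dvd m\<close> by simp
  then have "card {j. j < m * n \<and> e dvd Suc j} = (m div e) * n"
    using card_multiples[OF \<open>e > 0\<close>, of "(m div e) * n"] by metis
  then have card_X: "card (columns e (m * n) a d)
      = ((m * n + a - 1) choose a) * (((m div e) * n) choose d)"
    by (simp add: card_columns)
  have "n * card {cs \<in> columns e (m * n) a d. first_hit m (m * (t + b)) cs}
      = (t + b) * card (columns e (m * n) a d)"
  proof (rule rotation_closed_card)
    show "rotate m cs \<in> columns e (m * n) a d" if "cs \<in> columns e (m * n) a d" for cs
      using rotate_columns[OF \<open>e dvd m\<close> that] .
    show "finite (columns e (m * n) a d)"
      by (rule finite_columns)
  qed (use assms sum in \<open>auto simp: columns_def height_eq\<close>)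
  moreover have "card ?W = card {cs \<in> columns e (m * n) a d. first_hit m (m * (t + b)) cs}"
    using bij_betw_same_card[OF bij_path_cols[OF assms(1-3), of b e d]]
      bij_betw_same_card[OF bij_lower[OF assms(1) sum, of e]]
    by (simp add: d_def)
  ultimately have "n * card ?W = (t + b) * (((m * n + a - 1) choose a) * (((m div e) * n) choose d))"
    by (simp add: card_X)
  then have "real n * real (card ?W)
      = real (t + b) * (real ((m * n + a - 1) choose a) * real (((m div e) * n) choose d))"
    by (simp only: flip: of_nat_mult)
  then show ?thesis
    using \<open>n > 0\<close> by (simp add: d_def field_simps)
qed

theorem theorem1p2:
  fixes m n t a b :: nat
  assumes "m > 0" and "n > 0" and "t > 0" and "t \<le> n" and "a + b \<le> n - t"
  shows "real (card {w. small_schroeder m t n w \<and>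
            card (returns m n w) = b \<and> num_diag w = n - t - a - b}) =
          real (t + b) / real n * real ((m * n + a - 1) choose a) * real ((m * n) choose (n - t - a - b))
       \<and> real (card {w. small_schroeder m t n w \<and> m_divisible m w \<and>
            card (returns m n w) = b \<and> num_diag w = n - t - a - b}) =
          real (t + b) / real n * real ((m * n + a - 1) choose a) * real (n choose (n - t - a - b))"
proof -
  \<comment> \<open>Divisibility by 1 always holds, so \<open>e = 1\<close> gives the first count;
    \<open>e = m\<close> gives the second because \<open>m div m = 1\<close>.\<close>
  have "m_divisible 1 w" for w
    by (simp add: m_divisible_def)
  then show ?thesis
    using card_small_schroeder[OF assms, of 1] card_small_schroeder[OF assms, of m] \<open>m > 0\<close>
    by simp
qed

end
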